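(* Let $G$ be a graph with vertices $v_1,\dots,v_n$ and Seidel matrix $S$. For any vertex $v_i$, $$\mathcal{E}_S(v_i)=\frac{1}{\pi}\,\mathrm{p.v.}\int_{-\infty}^{\infty}\left(1-\mathrm{i}t\,\frac{\Phi_i(\mathrm{i}t)}{\Phi(\mathrm{i}t)}\right)dt,$$ where $\mathrm{i}=\sqrt{-1}$, $\Phi(\lambda)=\det(\lambda I-S)$, $\Phi_i(\lambda)=\det(\lambda I-S^{(i)})$ with $S^{(i)}$ the principal submatrix of $S$ obtained by deleting the $i$-th row and column, and p.v. denotes the Cauchy principal value.
   Context: All graphs are finite, simple and undirected. The Seidel matrix of a graph $G$ with vertex set $\{v_1,\dots,v_n\}$ is the real symmetric $n\times n$ matrix $S(G)=[s_{ij}]$ with $s_{ii}=0$, and for $i\neq j$, $s_{ij}=-1$ if $v_i$ and $v_j$ are adjacent and $s_{ij}=1$ otherwise. For a real symmetric matrix $S$, $|S|=(S^2)^{1/2}$ is the positive semidefinite square root of $S^2$. The vertex Seidel energy of $v_i$ is $\mathcal{E}_S(v_i)=|S(G)|_{ii}$, the $i$-th diagonal entry of $|S(G)|$. The Cauchy principal value at infinity is $\mathrm{p.v.}\int_{-\infty}^{\infty} f(t)\,dt=\lim_{R\to\infty}\int_{-R}^{R} f(t)\,dt$; if $\Phi(0)=0$, the integrand is not defined by the formula at the single point $t=0$, and its value there is immaterial. *)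

theory Defs
  imports
    "Graph_Theory.Digraph"
    "Jordan_Normal_Form.Determinant"
    "HOL-Analysis.Henstock_Kurzweil_Integration"
begin

text \<open>
  Finite simple undirected graphs are the digraphs satisfying the locale predicate
  \<^const>\<open>graph\<close>: finite, loop-free, without parallel arcs, and symmetric.  An edge
  joining \<open>u\<close> and \<open>v\<close> is the pair of arcs \<open>u \<rightarrow> v\<close>, \<open>v \<rightarrow> u\<close>.
\<close>

text \<open>
  The numbering \<open>v\<^sub>1, \<dots>, v\<^sub>n\<close> of the vertices is a list \<open>vs\<close>; matrix rows and columns
  are numbered from \<open>0\<close>.
\<close>

definition vertex_enumeration :: "('a, 'b) pre_digraph \<Rightarrow> 'a list \<Rightarrow> bool" where
  "vertex_enumeration G vs \<longleftrightarrow> distinct vs \<and> set vs = verts G"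

definition seidel_mat :: "('a, 'b) pre_digraph \<Rightarrow> 'a list \<Rightarrow> real mat" where
  "seidel_mat G vs = Matrix.mat (length vs) (length vs)
     (\<lambda>(i, j). if i = j then 0 else if vs ! i \<rightarrow>\<^bsub>G\<^esub> vs ! j then -1 else 1)"

definition psd_mat :: "real mat \<Rightarrow> bool" where
  "psd_mat B \<longleftrightarrow> B \<in> carrier_mat (dim_row B) (dim_row B) \<and> transpose_mat B = B \<and>
     (\<forall>x \<in> carrier_vec (dim_row B). 0 \<le> x \<bullet> (B *\<^sub>v x))"

text \<open>
  A positive semidefinite matrix has exactly one positive semidefinite square root, so the
  description below denotes it whenever \<open>psd_mat M\<close>.
\<close>

definition psd_sqrt_mat :: "real mat \<Rightarrow> real mat" where
  "psd_sqrt_mat M = (THE B. B \<in> carrier_mat (dim_row M) (dim_row M) \<and> psd_mat B \<and> B * B = M)"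

definition abs_mat :: "real mat \<Rightarrow> real mat" where
  "abs_mat S = psd_sqrt_mat (S * S)"

definition vertex_seidel_energy :: "('a, 'b) pre_digraph \<Rightarrow> 'a list \<Rightarrow> nat \<Rightarrow> real" where
  "vertex_seidel_energy G vs i = abs_mat (seidel_mat G vs) $$ (i, i)"

definition charpoly_at :: "real mat \<Rightarrow> complex \<Rightarrow> complex" where
  "charpoly_at A z = Determinant.det (z \<cdot>\<^sub>m 1\<^sub>m (dim_row A) - map_mat complex_of_real A)"

definition pv_integrable :: "(real \<Rightarrow> complex) \<Rightarrow> bool" where
  "pv_integrable f \<longleftrightarrow> (\<forall>R>0. f integrable_on {-R..R}) \<and>
     (\<exists>L. ((\<lambda>R. integral {-R..R} f) \<longlongrightarrow> L) at_top)"

definition pv_integral :: "(real \<Rightarrow> complex) \<Rightarrow> complex" where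
  "pv_integral f = Lim at_top (\<lambda>R. integral {-R..R} f)"

end

theory Submission
  imports Defs "Jordan_Normal_Form.Jordan_Normal_Form_Existence"
    "Jordan_Normal_Form.Jordan_Normal_Form_Uniqueness"
begin

text \<open>
  A real symmetric \<open>A\<close> is similar to a real diagonal matrix, \<open>A = P diag(d) P\<inverse>\<close>, and then
  \<open>\<bar>A\<bar> = P diag(\<bar>d\<bar>) P\<inverse>\<close>. By Cramer's rule \<open>\<Phi>\<^sub>i(z) / \<Phi>(z)\<close> is the \<open>(i, i)\<close> entry of the
  resolvent, that is \<open>\<Sum>\<^sub>j c\<^sub>j / (z - d\<^sub>j)\<close> with \<open>\<Sum>\<^sub>j c\<^sub>j = 1\<close>. So the integrand is
  \<open>\<Sum>\<^sub>j c\<^sub>j d\<^sub>j / (d\<^sub>j - \<i> t)\<close> for \<open>t \<noteq> 0\<close>, the integral of whose \<open>j\<close>-th term over \<open>[-R, R]\<close> is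
  \<open>2 c\<^sub>j d\<^sub>j arctan (R / d\<^sub>j)\<close>, which tends to \<open>\<pi> c\<^sub>j \<bar>d\<^sub>j\<bar>\<close>.
\<close>

unbundle no inner_syntax and no vec_syntax

section \<open>Diagonalization of real symmetric matrices\<close>

text \<open>Symmetry moves \<open>?A\<close> across the Hermitian product and real entries let it
  pass through conjugation, so \<open>e\<close> and \<open>conjugate e\<close> have the same product
  with \<open>v \<bullet>c v\<close>, which is nonzero.\<close>

lemma symmetric_real_eigenvalue_real:
  fixes A :: "real mat"
  assumes A: "A \<in> carrier_mat n n" and sym: "transpose_mat A = A"
    and ev: "eigenvalue (map_mat complex_of_real A) e"
  shows "e \<in> \<real>"
proof -
  let ?A = "map_mat complex_of_real A"
  have cA: "?A \<in> carrier_mat n n" using A by auto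
  have symC: "transpose_mat ?A = ?A"
    using A sym by (metis map_mat_transpose)
  from ev obtain v where v: "v \<in> carrier_vec n" "v \<noteq> 0\<^sub>v n" and eq: "?A *\<^sub>v v = e \<cdot>\<^sub>v v"
    unfolding eigenvalue_def eigenvector_def using A by auto
  have cv: "conjugate v \<in> carrier_vec n" using v by auto
  have conj_eq: "?A *\<^sub>v conjugate v = conjugate (?A *\<^sub>v v)"
    using A v by (intro eq_vecI) (auto simp: scalar_prod_def sum_conjugate conjugate_dist_mul)
  have "e * (v \<bullet>c v) = (?A *\<^sub>v v) \<bullet>c v" using v eq by simp
  also have "\<dots> = v \<bullet> (?A *\<^sub>v conjugate v)"
    using transpose_vec_mult_scalar[OF cA cv v(1)] symC by simp
  also have "\<dots> = v \<bullet> (conjugate e \<cdot>\<^sub>v conjugate v)"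
    unfolding conj_eq eq by (simp add: conjugate_smult_vec)
  also have "\<dots> = conjugate e * (v \<bullet>c v)" using v by simp
  finally have "e = conjugate e" using v by simp
  then show ?thesis by (simp add: Reals_cnj_iff)
qed

text \<open>Over the complex numbers the polynomial splits, and its roots, being eigenvalues, are
  real. The factorization therefore lies in the image of the injective embedding of real
  polynomials. A real Jordan form exists because of this splitting.\<close>

lemma symmetric_real_char_poly_factorized:
  fixes A :: "real mat"
  assumes A: "A \<in> carrier_mat n n" and sym: "transpose_mat A = A"
  shows "\<exists>es. char_poly A = (\<Prod>e\<leftarrow>es. [:- e, 1:])"
proof -
  let ?A = "map_mat complex_of_real A"
  have cA: "?A \<in> carrier_mat n n" using A by auto
  interpret map_poly_inj_idom_hom complex_of_real ..
  obtain cs where cs: "char_poly ?A = (\<Prod>c\<leftarrow>cs. [:- c, 1:])"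
    using char_poly_factorized[OF cA] by blast
  have real: "c \<in> \<real>" if "c \<in> set cs" for c
  proof -
    have "poly (char_poly ?A) c = 0" unfolding cs using that by (rule linear_poly_root)
    then show ?thesis
      using symmetric_real_eigenvalue_real[OF A sym] eigenvalue_root_char_poly[OF cA] by blast
  qed
  have "map_poly complex_of_real (char_poly A) = (\<Prod>c\<leftarrow>cs. [:- c, 1:])"
    using cs of_real_hom.char_poly_hom[OF A] by metis
  also have "\<dots> = (\<Prod>c\<leftarrow>cs. map_poly complex_of_real [:- Re c, 1:])"
    by (rule arg_cong[of _ _ prod_list], rule map_cong) (auto dest: real)
  also have "\<dots> = map_poly complex_of_real (\<Prod>c\<leftarrow>cs. [:- Re c, 1:])"
    by (simp add: hom_prod_list o_def)
  finally have "char_poly A = (\<Prod>c\<leftarrow>cs. [:- Re c, 1:])" by simp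
  then have "char_poly A = (\<Prod>e\<leftarrow>map Re cs. [:- e, 1:])" by (simp add: o_def)
  then show ?thesis by blast
qed

text \<open>The squared length of \<open>C *\<^sub>v v\<close> is
  \<open>v \<bullet> (C * C *\<^sub>v v)\<close>. With \<open>C\<close> a shift of \<open>A\<close>
  by an eigenvalue, this stops the chain of generalized eigenspaces at its first step.\<close>

lemma symmetric_real_kernel_square:
  fixes C :: "real mat"
  assumes C: "C \<in> carrier_mat n n" and sym: "transpose_mat C = C"
  shows "mat_kernel (C * C) = mat_kernel C"
proof
  show "mat_kernel (C * C) \<subseteq> mat_kernel C"
  proof
    fix v assume "v \<in> mat_kernel (C * C)"
    then have v: "v \<in> carrier_vec n" and 0: "(C * C) *\<^sub>v v = 0\<^sub>v n"
      using C by (auto simp: mat_kernel_def)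
    have Cv: "C *\<^sub>v v \<in> carrier_vec n" using C v by auto
    have "(C *\<^sub>v v) \<bullet> (C *\<^sub>v v) = v \<bullet> (C *\<^sub>v (C *\<^sub>v v))"
      using transpose_vec_mult_scalar[OF C Cv v] sym by simp
    also have "\<dots> = 0" using 0 C v by simp
    finally have "C *\<^sub>v v = 0\<^sub>v n"
      using conjugate_square_eq_0_vec[OF Cv] by simp
    then show "v \<in> mat_kernel C" using v C by (auto simp: mat_kernel_def)
  qed
  show "mat_kernel C \<subseteq> mat_kernel (C * C)"
    using C by (auto simp: mat_kernel_def)
qed

lemma diagonal_jordan_matrix:
  assumes "\<forall>(m, a) \<in> set n_as. m = 1"
  shows "diagonal_mat (jordan_matrix n_as)"
  using assms
proof (induct n_as)
  case Nil
  then show ?case by (simp add: jordan_matrix_def diagonal_mat_def)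
next
  case (Cons p n_as)
  obtain a where p: "p = (1, a)" using Cons.prems by (cases p) auto
  let ?J = "jordan_matrix n_as"
  have J: "diagonal_mat ?J" using Cons by auto
  have "jordan_matrix (p # n_as) =
      four_block_mat (jordan_block 1 a) (0\<^sub>m 1 (dim_col ?J)) (0\<^sub>m (dim_row ?J) 1) ?J"
    unfolding p jordan_matrix_def by (simp add: Let_def)
  then show ?case using J by (auto simp: diagonal_mat_def)
qed

lemma symmetric_real_diagonalizable:
  fixes A :: "real mat"
  assumes A: "A \<in> carrier_mat n n" and sym: "transpose_mat A = A"
  obtains P Q d where "similar_mat_wit A (mat_diag n d) P Q"
proof -
  obtain es where "char_poly A = (\<Prod>e\<leftarrow>es. [:- e, 1:])"
    using symmetric_real_char_poly_factorized[OF A sym] by blast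
  then obtain n_as where jnf: "jordan_nf A n_as"
    using jordan_nf_exists[OF A] by blast
  text \<open>The number of blocks of size at least 2 for \<open>e\<close> is the dimension of
    \<open>ker (A - e)\<^sup>2\<close> minus that of \<open>ker (A - e)\<close>.\<close>
  have block: "m = 1" if mem: "(m, e) \<in> set n_as" for m e
  proof -
    let ?C = "char_matrix A e"
    let ?ms = "map fst (filter (\<lambda>(n, e'). e' = e) n_as)"
    have C: "?C \<in> carrier_mat n n" using A by simp
    have "A $$ (k, l) = A $$ (l, k)" if "k < n" "l < n" for k l
      using A sym that by (metis carrier_matD index_transpose_mat(1))
    then have "transpose_mat ?C = ?C" using A
      by (intro eq_matI) (auto simp: char_matrix_def)
    then have "mat_kernel (?C * ?C) = mat_kernel ?C"
      by (rule symmetric_real_kernel_square[OF C])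
    then have "kernel_dim (?C * ?C) = kernel_dim ?C"
      using C by (simp add: kernel_dim_def)
    then have "dim_gen_eigenspace A e 2 = dim_gen_eigenspace A e 1"
      using C by (simp add: dim_gen_eigenspace_def numeral_2_eq_2)
    then have eq: "sum_list (map (min 2) ?ms) = sum_list (map (min 1) ?ms)"
      unfolding dim_gen_eigenspace[OF jnf] .
    \<comment> \<open>The kernel of the \<open>k\<close>-th power of \<open>?C\<close> has as
      dimension the sum of \<open>min k m\<close> over the sizes \<open>m\<close> of the blocks for
      \<open>e\<close>. Since \<open>min 1\<close> is termwise at most \<open>min 2\<close>, equal
      sums force equal terms.\<close>
    have *: "sum_list (map (min 1) xs) \<le> sum_list (map (min 2) xs) \<and>
       (sum_list (map (min 2) xs) = sum_list (map (min 1) xs) \<longrightarrow> (\<forall>x\<in>set xs. x \<le> 1))"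
      for xs :: "nat list"
      by (induct xs) auto
    have "m \<in> set ?ms" using mem by force
    with * eq have "m \<le> 1" by blast
    moreover have "m \<noteq> 0" using jnf mem by (force simp: jordan_nf_def)
    ultimately show ?thesis by simp
  qed
  let ?J = "jordan_matrix n_as"
  from jnf obtain P Q where w: "similar_mat_wit A ?J P Q"
    unfolding jordan_nf_def similar_mat_def by blast
  have J: "?J \<in> carrier_mat n n" using similar_mat_witD2[OF A w] by simp
  have "diagonal_mat ?J" by (rule diagonal_jordan_matrix) (use block in auto)
  then have "?J = mat_diag n (\<lambda>j. ?J $$ (j, j))"
    using J by (intro eq_matI) (auto simp: diagonal_mat_def mat_diag_def)
  with w that show thesis by metis
qed

section \<open>Functions of a diagonalized matrix\<close>

lemma conj_mat_diag_index:
  fixes P Q :: "'a::comm_semiring_1 mat"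
  assumes "P \<in> carrier_mat n n" "Q \<in> carrier_mat n n" "k < n" "l < n"
  shows "(P * mat_diag n g * Q) $$ (k, l) = (\<Sum>j<n. P $$ (k, j) * Q $$ (j, l) * g j)"
  using assms
  by (auto simp: mat_diag_mult_right[of P n] scalar_prod_def lessThan_atLeast0 ac_simps
      intro!: sum.cong)

text \<open>The inner factor \<open>Q * P\<close> cancels, so sending \<open>g\<close> to
  \<open>P * mat_diag n g * Q\<close> is multiplicative. Squares, square roots and inverses are all
  computed through this.\<close>

lemma conj_mat_diag_mult:
  fixes P Q :: "'a::comm_semiring_1 mat"
  assumes [simp]: "P \<in> carrier_mat n n" "Q \<in> carrier_mat n n" and QP: "Q * P = 1\<^sub>m n"
  shows "(P * mat_diag n g * Q) * (P * mat_diag n h * Q) = P * mat_diag n (\<lambda>j. g j * h j) * Q"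
proof -
  have "Q * (P * X) = X" if "X \<in> carrier_mat n n" for X
    using that QP assoc_mult_mat[of Q n n P n X n] by simp
  moreover have "mat_diag n g * (mat_diag n h * Q) = mat_diag n (\<lambda>j. g j * h j) * Q"
    using assoc_mult_mat[of "mat_diag n g" n n "mat_diag n h" n Q n] by simp
  ultimately show ?thesis
    by (simp add: assoc_mult_mat[of _ n n _ n _ n] mult_carrier_mat[of _ n n _ n])
qed

text \<open>
  No orthogonality of \<open>P\<close> is needed: symmetry of \<open>A\<close> makes the Gram matrix of the columns
  of \<open>P\<close> commute with \<open>diag d\<close>, hence also with every function of it.
\<close>

lemma transpose_conj_mat_diag:
  fixes A :: "'a::field mat"
  assumes A: "A \<in> carrier_mat n n" and sym: "transpose_mat A = A"
    and wit: "similar_mat_wit A (mat_diag n d) P Q"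
  shows "transpose_mat (P * mat_diag n (\<lambda>j. g (d j)) * Q) = P * mat_diag n (\<lambda>j. g (d j)) * Q"
proof -
  note w = similar_mat_witD2[OF A wit]
  note [simp] = w(4-7)
  note assoc = assoc_mult_mat[of _ n n _ n _ n] mult_carrier_mat[of _ n n _ n]
  let ?D = "mat_diag n d" and ?G = "mat_diag n (\<lambda>j. g (d j))"
  define K where "K = transpose_mat P * P"
  have K [simp]: "K \<in> carrier_mat n n" unfolding K_def by (rule mult_carrier_mat[of _ n n]) auto
  have tr: "transpose_mat (mat_diag n h) = mat_diag n h" for h :: "nat \<Rightarrow> 'a"
    by (rule eq_matI) (auto simp: mat_diag_def)
  have tmult: "transpose_mat (X * Y) = transpose_mat Y * transpose_mat X"
    if "X \<in> carrier_mat n n" "Y \<in> carrier_mat n n" for X Y :: "'a mat"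
    using that by (rule transpose_mult)
  have AP: "A * P = P * ?D"
    using w(2) by (subst w(3)) (simp add: assoc right_mult_one_mat[of _ n n])
  have KD: "K * ?D = transpose_mat P * (A * P)" unfolding AP K_def by (simp add: assoc)
  have DK: "?D * K = transpose_mat (K * ?D)" unfolding K_def by (simp add: tmult tr assoc)
  have "?D * K = K * ?D" unfolding DK KD by (simp add: tmult sym assoc)
  then have comm: "(?D * K) $$ (k, l) = (K * ?D) $$ (k, l)" for k l by simp
  have "d k * K $$ (k, l) = K $$ (k, l) * d l" if "k < n" "l < n" for k l
    using that comm[of k l]
    by (simp add: mat_diag_mult_left[OF K] mat_diag_mult_right[OF K])
  \<comment> \<open>A nonzero entry of \<open>K\<close> links only equal eigenvalues, and these also
    have equal images under \<open>g\<close>.\<close>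
  then have "d k = d l" if "k < n" "l < n" "K $$ (k, l) \<noteq> 0" for k l
    using that by (metis mult.commute mult_cancel_left)
  then have "g (d k) * K $$ (k, l) = K $$ (k, l) * g (d l)" if "k < n" "l < n" for k l
    using that by (cases "K $$ (k, l) = 0") (auto simp: mult.commute)
  then have GK: "?G * K = K * ?G"
    unfolding mat_diag_mult_left[OF K] mat_diag_mult_right[OF K] by (intro eq_matI) auto
  have PQ: "P * (Q * X) = X" if "X \<in> carrier_mat n n" for X
    using that w(1) assoc_mult_mat[of P n n Q n X n] by simp
  have PQt: "transpose_mat Q * (transpose_mat P * X) = X" if "X \<in> carrier_mat n n" for X
    using that tmult[of P Q, symmetric] w(1) assoc_mult_mat[of "transpose_mat Q" n n "transpose_mat P" n X n]
    by simp
  have "transpose_mat (P * ?G * Q) = transpose_mat Q * (?G * transpose_mat P)"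
    by (simp add: tmult tr assoc)
  \<comment> \<open>Inserting \<open>P * Q = 1\<close> after \<open>transpose_mat P\<close> turns it
    into \<open>K * Q\<close>.\<close>
  also have "\<dots> = transpose_mat Q * ((?G * K) * Q)"
    unfolding K_def using w(1) by (simp add: assoc right_mult_one_mat[of _ n n])
  also have "\<dots> = P * ?G * Q"
    unfolding GK unfolding K_def by (simp add: assoc PQt)
  finally show ?thesis .
qed

section \<open>Positive semidefinite square roots and the absolute value\<close>

text \<open>The quadratic form at \<open>x\<close> is the squared length of
  \<open>R *\<^sub>v x\<close>.\<close>

lemma psd_mat_square_symmetric:
  fixes R :: "real mat"
  assumes R: "R \<in> carrier_mat n n" and sym: "transpose_mat R = R"
  shows "psd_mat (R * R)"
  unfolding psd_mat_def
proof (intro conjI ballI)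
  show "R * R \<in> carrier_mat (dim_row (R * R)) (dim_row (R * R))" using R by auto
  show "transpose_mat (R * R) = R * R" using transpose_mult[OF R R] sym by simp
  fix x :: "real Matrix.vec"
  assume "x \<in> carrier_vec (dim_row (R * R))"
  then have x: "x \<in> carrier_vec n" using R by auto
  have Rx: "R *\<^sub>v x \<in> carrier_vec n" using R x by auto
  have "x \<bullet> (R * R *\<^sub>v x) = (R *\<^sub>v x) \<bullet> (R *\<^sub>v x)"
    using transpose_vec_mult_scalar[OF R x Rx] R x sym
      transpose_vec_mult_scalar[OF R Rx x] comm_scalar_prod[OF x, of "R *\<^sub>v (R *\<^sub>v x)"] by simp
  then show "0 \<le> x \<bullet> (R * R *\<^sub>v x)"
    using conjugate_square_ge_0_vec[of "R *\<^sub>v x"] by simp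
qed

lemma mult_mat_vec_zero_right:
  fixes A :: "'a::semiring_0 mat"
  assumes "A \<in> carrier_mat m n"
  shows "A *\<^sub>v 0\<^sub>v n = 0\<^sub>v m"
  using assms by (intro eq_vecI) auto

text \<open>Compare the columns of \<open>A * P = P * mat_diag n d\<close>; a column of
  \<open>P\<close> is nonzero because \<open>Q\<close> sends it to a unit vector.\<close>

lemma similar_diag_eigenvector:
  fixes A :: "'a::field mat"
  assumes A: "A \<in> carrier_mat n n" and wit: "similar_mat_wit A (mat_diag n d) P Q" and j: "j < n"
  shows "eigenvector A (col P j) (d j)"
proof -
  note w = similar_mat_witD2[OF A wit]
  note [simp] = w(4-7)
  have AP: "A * P = P * mat_diag n d"
    using w(2) by (subst w(3)) (simp add: assoc_mult_mat[of _ n n _ n _ n] mult_carrier_mat[of _ n n _ n]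
        right_mult_one_mat[of _ n n])
  have "A *\<^sub>v col P j = col (A * P) j"
    by (rule col_mult2[symmetric, of _ n n _ n]) (use j in auto)
  also have "\<dots> = d j \<cdot>\<^sub>v col P j"
    unfolding AP mat_diag_mult_right[OF w(6)]
    using j carrier_matD[OF w(6)] by (intro eq_vecI) (auto simp: col_def mult.commute)
  finally have eq: "A *\<^sub>v col P j = d j \<cdot>\<^sub>v col P j" .
  have "Q *\<^sub>v col P j = unit_vec n j"
    using col_mult2[of Q n n P n j] w(2) j by simp
  then have "col P j \<noteq> 0\<^sub>v n"
    using j w(7) mult_mat_vec_zero_right by (metis unit_vec_nonzero)
  then show ?thesis
    using eq carrier_matD[OF A] carrier_matD[OF w(6)] col_dim[of P j]
    unfolding eigenvector_def by simp
qed

text \<open>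
  With \<open>D = X - Y\<close> we have \<open>X D + D Y = X\<^sup>2 - Y\<^sup>2 = 0\<close>. An eigenvector \<open>v\<close> of \<open>D\<close> for an
  eigenvalue \<open>d \<noteq> 0\<close> then satisfies \<open>v\<^sup>T X v + v\<^sup>T Y v = 0\<close>, so both terms vanish and
  \<open>d v\<^sup>T v = v\<^sup>T D v = 0\<close>.
\<close>

lemma psd_mat_square_unique:
  fixes X Y :: "real mat"
  assumes X: "X \<in> carrier_mat n n" "psd_mat X" and Y: "Y \<in> carrier_mat n n" "psd_mat Y"
    and eq: "X * X = Y * Y"
  shows "X = Y"
proof -
  let ?D = "X - Y"
  have D [simp]: "?D \<in> carrier_mat n n" using Y(1) by (rule minus_carrier_mat)
  have symX: "transpose_mat X = X" and symY: "transpose_mat Y = Y"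
    using X Y by (auto simp: psd_mat_def)
  have symD: "transpose_mat ?D = ?D"
    using transpose_minus[OF X(1) Y(1)] symX symY by simp
  obtain P Q d where wit: "similar_mat_wit ?D (mat_diag n d) P Q"
    using symmetric_real_diagonalizable[OF D symD] .
  note w = similar_mat_witD2[OF D wit]
  have d0: "d j = 0" if j: "j < n" for j
  proof (rule ccontr)
    assume nz: "d j \<noteq> 0"
    define v where "v = col P j"
    have "eigenvector ?D v (d j)"
      unfolding v_def by (rule similar_diag_eigenvector[OF D wit j])
    then have v [simp]: "v \<in> carrier_vec n" and v0: "v \<noteq> 0\<^sub>v n" and Dv: "?D *\<^sub>v v = d j \<cdot>\<^sub>v v"
      unfolding eigenvector_def carrier_matD(1)[OF D] by blast+
    have Xv [simp]: "X *\<^sub>v v \<in> carrier_vec n" and Yv [simp]: "Y *\<^sub>v v \<in> carrier_vec n"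
      using X(1) Y(1) v by auto
    have split: "?D *\<^sub>v v = X *\<^sub>v v - Y *\<^sub>v v"
      by (rule minus_mult_distrib_mat_vec[OF X(1) Y(1) v])
    have pos: "0 \<le> v \<bullet> (X *\<^sub>v v)" "0 \<le> v \<bullet> (Y *\<^sub>v v)"
      using X Y v by (auto simp: psd_mat_def)
    have XDv: "v \<bullet> (X *\<^sub>v (?D *\<^sub>v v)) = d j * (v \<bullet> (X *\<^sub>v v))"
      unfolding Dv mult_mat_vec[OF X(1) v] by (rule scalar_prod_smult_distrib[OF v Xv])
    have DYv: "v \<bullet> (?D *\<^sub>v (Y *\<^sub>v v)) = d j * (v \<bullet> (Y *\<^sub>v v))"
      using transpose_vec_mult_scalar[OF D Yv v] smult_scalar_prod_distrib[OF v Yv]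
      unfolding symD Dv by simp
    have 1: "X *\<^sub>v (?D *\<^sub>v v) = (X * X) *\<^sub>v v - X *\<^sub>v (Y *\<^sub>v v)"
      unfolding split mult_minus_distrib_mat_vec[OF X(1) Xv Yv] using X(1) v by simp
    have 2: "?D *\<^sub>v (Y *\<^sub>v v) = X *\<^sub>v (Y *\<^sub>v v) - (Y * Y) *\<^sub>v v"
      unfolding minus_mult_distrib_mat_vec[OF X(1) Y(1) Yv] using Y(1) v by simp
    have XYv: "X *\<^sub>v (Y *\<^sub>v v) \<in> carrier_vec n" and YYv: "Y * Y *\<^sub>v v \<in> carrier_vec n"
      using X(1) Y(1) Yv v by auto
    have "v \<bullet> (X *\<^sub>v (?D *\<^sub>v v)) + v \<bullet> (?D *\<^sub>v (Y *\<^sub>v v)) = 0"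
      unfolding 1 2 eq scalar_prod_minus_distrib[OF v XYv YYv] scalar_prod_minus_distrib[OF v YYv XYv]
      by simp
    then have "d j * (v \<bullet> (X *\<^sub>v v) + v \<bullet> (Y *\<^sub>v v)) = 0"
      unfolding XDv DYv by (simp add: distrib_left)
    with nz pos have "v \<bullet> (X *\<^sub>v v) = 0" "v \<bullet> (Y *\<^sub>v v) = 0" by auto
    then have "v \<bullet> (?D *\<^sub>v v) = 0"
      unfolding split scalar_prod_minus_distrib[OF v Xv Yv] by simp
    then have "v \<bullet> v = 0" using scalar_prod_smult_distrib[OF v v] nz unfolding Dv by simp
    then show False using v0 conjugate_square_eq_0_vec[OF v] by simp
  qed
  have "mat_diag n d = 0\<^sub>m n n" by (rule eq_matI) (auto simp: mat_diag_def d0)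
  then have "?D = 0\<^sub>m n n" using w by simp
  then have "(X - Y) $$ (k, l) = 0" if "k < n" "l < n" for k l using that by simp
  then show "X = Y"
    by (intro eq_matI) (auto simp: carrier_matD[OF X(1)] carrier_matD[OF Y(1)])
qed

text \<open>The candidate \<open>?B\<close> is positive semidefinite as the square of the symmetric
  matrix \<open>?R\<close>, and \<open>?B * ?B = A * A\<close> since \<open>\<bar>d j\<bar>\<close>
  and \<open>d j\<close> have the same square. Uniqueness of the root then settles the definite
  description.\<close>

lemma abs_mat_similar_diag:
  fixes A :: "real mat"
  assumes A: "A \<in> carrier_mat n n" and sym: "transpose_mat A = A"
    and wit: "similar_mat_wit A (mat_diag n d) P Q"
  shows "abs_mat A = P * mat_diag n (\<lambda>j. \<bar>d j\<bar>) * Q"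
proof -
  note w = similar_mat_witD2[OF A wit]
  note mult = conj_mat_diag_mult[OF w(6,7,2)]
  let ?B = "P * mat_diag n (\<lambda>j. \<bar>d j\<bar>) * Q"
  let ?R = "P * mat_diag n (\<lambda>j. sqrt \<bar>d j\<bar>) * Q"
  have R: "?R \<in> carrier_mat n n" and B: "?B \<in> carrier_mat n n" using w by auto
  have "psd_mat (?R * ?R)"
    by (rule psd_mat_square_symmetric[OF R transpose_conj_mat_diag[OF A sym wit]])
  then have psd: "psd_mat ?B" unfolding mult by simp
  have sq: "?B * ?B = A * A"
    unfolding mult abs_mult_self_eq using mult[of d d] w(3) by metis
  show ?thesis
    unfolding abs_mat_def psd_sqrt_mat_def
  proof (rule the_equality)
    show "?B \<in> carrier_mat (dim_row (A * A)) (dim_row (A * A)) \<and> psd_mat ?B \<and> ?B * ?B = A * A"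
      using A B psd sq by simp
  next
    fix X
    assume "X \<in> carrier_mat (dim_row (A * A)) (dim_row (A * A)) \<and> psd_mat X \<and> X * X = A * A"
    then have "X \<in> carrier_mat n n" "psd_mat X" "X * X = ?B * ?B" using A sq by auto
    then show "X = ?B" using psd_mat_square_unique B psd by blast
  qed
qed

section \<open>Diagonal entries of the resolvent\<close>

lemma conj_mat_diag_one_index:
  fixes P Q :: "'a::comm_semiring_1 mat"
  assumes "P \<in> carrier_mat n n" "Q \<in> carrier_mat n n" "P * Q = 1\<^sub>m n" "k < n" "l < n"
  shows "(\<Sum>j<n. P $$ (k, j) * Q $$ (j, l)) = (if k = l then 1 else 0)"
  using conj_mat_diag_index[OF assms(1,2,4,5), of "\<lambda>_. 1"] assms by simp

lemma charpoly_minor_quotient: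
  fixes A :: "real mat"
  assumes A: "A \<in> carrier_mat n n" and wit: "similar_mat_wit A (mat_diag n d) P Q"
    and i: "i < n" and z: "\<And>j. j < n \<Longrightarrow> z \<noteq> of_real (d j)"
  shows "charpoly_at (mat_delete A i i) z / charpoly_at A z =
    (\<Sum>j<n. of_real (P $$ (i, j) * Q $$ (j, i)) / (z - of_real (d j)))"
proof -
  note w = similar_mat_witD2[OF A wit]
  let ?P = "map_mat complex_of_real P" and ?Q = "map_mat complex_of_real Q"
  define M where "M = z \<cdot>\<^sub>m 1\<^sub>m n - map_mat complex_of_real A"
  define R where "R = ?P * mat_diag n (\<lambda>j. 1 / (z - of_real (d j))) * ?Q"
  have P: "?P \<in> carrier_mat n n" and Q: "?Q \<in> carrier_mat n n" using w by auto
  have M: "M \<in> carrier_mat n n" using A by (auto simp: M_def)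
  have R: "R \<in> carrier_mat n n"
    unfolding R_def by (intro mult_carrier_mat[of _ n n] P Q mat_diag_dim)
  have PQ: "?P * ?Q = 1\<^sub>m n" and QP: "?Q * ?P = 1\<^sub>m n"
    using of_real_hom.mat_hom_mult[OF w(6,7)] of_real_hom.mat_hom_mult[OF w(7,6)] w(1,2)
    by (metis of_real_hom.mat_hom_one)+
  have M_eq: "M = ?P * mat_diag n (\<lambda>j. z - of_real (d j)) * ?Q"
  proof (rule eq_matI)
    fix k l
    assume "k < dim_row (?P * mat_diag n (\<lambda>j. z - of_real (d j)) * ?Q)"
      "l < dim_col (?P * mat_diag n (\<lambda>j. z - of_real (d j)) * ?Q)"
    then have kl: "k < n" "l < n" using P Q by auto
    have A_kl: "A $$ (k, l) = (\<Sum>j<n. P $$ (k, j) * Q $$ (j, l) * d j)"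
      using conj_mat_diag_index[OF w(6,7) kl] w(3) by metis
    have "M $$ (k, l) = (if k = l then 1 else 0) * z - of_real (A $$ (k, l))"
      using kl A by (simp add: M_def)
    also have "\<dots> = (\<Sum>j<n. ?P $$ (k, j) * ?Q $$ (j, l) * (z - of_real (d j)))"
      unfolding conj_mat_diag_one_index[OF P Q PQ kl, symmetric] A_kl
      using kl w(6,7) by (simp add: sum_distrib_right right_diff_distrib sum_subtractf)
    finally show "M $$ (k, l) = (?P * mat_diag n (\<lambda>j. z - of_real (d j)) * ?Q) $$ (k, l)"
      unfolding conj_mat_diag_index[OF P Q kl] .
  qed (use M P Q in auto)
  have diag: "mat_diag n (\<lambda>j. (z - of_real (d j)) * (1 / (z - of_real (d j)))) = 1\<^sub>m n"
    using z by (intro eq_matI) (auto simp: mat_diag_def)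
  have MR: "M * R = 1\<^sub>m n"
    unfolding M_eq R_def conj_mat_diag_mult[OF P Q QP] diag using P PQ by simp
  have "Determinant.det M * Determinant.det R = 1"
    using det_mult[OF M R] MR by simp
  then have det: "Determinant.det M \<noteq> 0" by auto
  have adj: "adj_mat M \<in> carrier_mat n n" by (rule adj_mat(1)[OF M])
  \<comment> \<open>Since \<open>R\<close> inverts \<open>M\<close>, this expresses the adjugate as
    \<open>Determinant.det M\<close> times \<open>R\<close>; its \<open>(i, i)\<close> entry is the
    principal minor, the cofactor sign having even exponent \<open>i + i\<close>.\<close>
  have "adj_mat M = adj_mat M * (M * R)" using adj MR by simp
  also have "\<dots> = (Determinant.det M \<cdot>\<^sub>m 1\<^sub>m n) * R"
    using assoc_mult_mat[OF adj M R] adj_mat(3)[OF M] by simp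
  also have "\<dots> = Determinant.det M \<cdot>\<^sub>m R"
    using R by (simp add: mult_smult_assoc_mat[of _ n n])
  finally have "adj_mat M $$ (i, i) = Determinant.det M * R $$ (i, i)" using R i by simp
  moreover have "adj_mat M $$ (i, i) = Determinant.det (mat_delete M i i)"
    using M i by (simp add: adj_mat_def cofactor_def power_add[symmetric] mult_2[symmetric])
  \<comment> \<open>Deleting the same row and column keeps the diagonal on the diagonal, so the
    minor is again a characteristic matrix at \<open>z\<close>.\<close>
  moreover have "mat_delete M i i =
      z \<cdot>\<^sub>m 1\<^sub>m (dim_row (mat_delete A i i)) - map_mat complex_of_real (mat_delete A i i)"
    using A i by (intro eq_matI) (auto simp: M_def mat_delete_def)
  ultimately have "charpoly_at (mat_delete A i i) z = charpoly_at A z * R $$ (i, i)"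
    using A by (simp add: charpoly_at_def M_def)
  moreover have "charpoly_at A z \<noteq> 0" using det A by (simp add: charpoly_at_def M_def)
  ultimately have "charpoly_at (mat_delete A i i) z / charpoly_at A z = R $$ (i, i)" by simp
  also have "\<dots> = (\<Sum>j<n. of_real (P $$ (i, j) * Q $$ (j, i)) / (z - of_real (d j)))"
    unfolding R_def conj_mat_diag_index[OF P Q i i] using i w(6,7) by simp
  finally show ?thesis .
qed

section \<open>The integral of one spectral term\<close>

text \<open>For \<open>d = 0\<close> both sides vanish because division by zero gives zero.\<close>

lemma has_integral_resolvent_term:
  fixes d R :: real
  assumes "0 \<le> R"
  shows "((\<lambda>t. of_real d / (of_real d - \<i> * of_real t)) has_integral
    complex_of_real (2 * d * arctan (R / d))) {-R..R}"
proof (cases "d = 0")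
  case True
  then show ?thesis by simp
next
  case d: False
  \<comment> \<open>An antiderivative split into real and imaginary parts, which avoids branches of
    the complex logarithm. The derivatives come from expanding the integrand by the conjugate of its
    denominator.\<close>
  define F where "F t = complex_of_real (d * arctan (t / d))
      + \<i> * complex_of_real (d / 2 * ln (d\<^sup>2 + t\<^sup>2))" for t
  have "((\<lambda>t. of_real d / (of_real d - \<i> * of_real t)) has_integral (F R - F (-R))) {-R..R}"
  proof (rule fundamental_theorem_of_calculus)
    fix t
    have pos: "0 < d\<^sup>2 + t\<^sup>2" using d by (simp add: sum_power2_gt_zero_iff)
    have 1: "((\<lambda>t. d * arctan (t / d)) has_real_derivative d\<^sup>2 / (d\<^sup>2 + t\<^sup>2)) (at t within {-R..R})"
      using d pos by (auto intro!: derivative_eq_intros simp: divide_simps power2_eq_square)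
    have 2: "((\<lambda>t. d / 2 * ln (d\<^sup>2 + t\<^sup>2)) has_real_derivative d * t / (d\<^sup>2 + t\<^sup>2)) (at t within {-R..R})"
      using d pos by (auto intro!: derivative_eq_intros simp: divide_simps)
    have nz: "complex_of_real d + \<i> * of_real t \<noteq> 0" using d by (simp add: complex_eq_iff)
    have "complex_of_real d / (of_real d - \<i> * of_real t)
        = of_real d * (of_real d + \<i> * of_real t)
          / ((of_real d - \<i> * of_real t) * (of_real d + \<i> * of_real t))"
      using nz by (rule nonzero_mult_divide_mult_cancel_right[symmetric])
    moreover have "(complex_of_real d - \<i> * of_real t) * (of_real d + \<i> * of_real t) = of_real (d\<^sup>2 + t\<^sup>2)"
      by (simp add: algebra_simps power2_eq_square)
    ultimately have eq: "complex_of_real d / (of_real d - \<i> * of_real t)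
        = of_real (d\<^sup>2 / (d\<^sup>2 + t\<^sup>2)) + \<i> * of_real (d * t / (d\<^sup>2 + t\<^sup>2))"
      by (simp add: add_divide_distrib power2_eq_square algebra_simps)
    have "(F has_vector_derivative
        of_real (d\<^sup>2 / (d\<^sup>2 + t\<^sup>2)) + \<i> * of_real (d * t / (d\<^sup>2 + t\<^sup>2))) (at t within {-R..R})"
      unfolding F_def
      by (intro has_vector_derivative_add has_vector_derivative_mult_right
          has_vector_derivative_of_real 1 2)
    then show "(F has_vector_derivative of_real d / (of_real d - \<i> * of_real t)) (at t within {-R..R})"
      unfolding eq .
  qed (use assms in simp)
  \<comment> \<open>The logarithmic part is even in \<open>t\<close> and cancels over the symmetric
    interval; the arctangent part is odd and doubles.\<close>
  moreover have "F R - F (-R) = complex_of_real (2 * d * arctan (R / d))"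
    by (simp add: F_def arctan_minus)
  ultimately show ?thesis by simp
qed

text \<open>The expression is even in \<open>d\<close>, so negative \<open>d\<close> reduces to
  positive \<open>d\<close>, where the arctangent tends to \<open>pi / 2\<close>. This is where the
  absolute value of an eigenvalue appears.\<close>

lemma tendsto_mult_arctan_divide:
  fixes d :: real
  shows "((\<lambda>R. 2 * d * arctan (R / d)) \<longlongrightarrow> pi * \<bar>d\<bar>) at_top"
proof -
  have pos: "((\<lambda>R. 2 * c * arctan (R / c)) \<longlongrightarrow> pi * c) at_top" if "0 < c" for c :: real
  proof -
    have "filterlim (\<lambda>R. R / c) at_top at_top"
      using filterlim_tendsto_pos_mult_at_top[OF tendsto_const, of "inverse c" "\<lambda>R. R" at_top] that
      by (simp add: filterlim_ident divide_inverse mult.commute)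
    then have "((\<lambda>R. 2 * c * arctan (R / c)) \<longlongrightarrow> 2 * c * (pi / 2)) at_top"
      by (intro tendsto_mult tendsto_const filterlim_compose[OF tendsto_arctan_at_top])
    then show ?thesis by (simp add: mult.commute)
  qed
  consider "d = 0" | "0 < d" | "0 < - d" by linarith
  then show ?thesis
  proof cases
    case 3
    then show ?thesis using pos[of "- d"] by (simp add: arctan_minus)
  qed (use pos[of d] in auto)
qed

section \<open>The principal value formula for symmetric matrices\<close>

lemma Coulson_integral_abs_mat:
  fixes A :: "real mat"
  assumes A: "A \<in> carrier_mat n n" and sym: "transpose_mat A = A" and i: "i < n"
  defines "f \<equiv> (\<lambda>t::real. 1 - \<i> * complex_of_real t *
    (charpoly_at (mat_delete A i i) (\<i> * complex_of_real t) / charpoly_at A (\<i> * complex_of_real t)))"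
  shows "pv_integrable f" and "pv_integral f = complex_of_real (pi * abs_mat A $$ (i, i))"
proof -
  obtain P Q d where wit: "similar_mat_wit A (mat_diag n d) P Q"
    using symmetric_real_diagonalizable[OF A sym] .
  note w = similar_mat_witD2[OF A wit]
  define c where "c j = P $$ (i, j) * Q $$ (j, i)" for j
  have c_sum: "(\<Sum>j<n. c j) = 1"
    using conj_mat_diag_one_index[OF w(6,7,1) i i] by (simp add: c_def)
  have f_eq: "f t = (\<Sum>j<n. of_real (c j) * (of_real (d j) / (of_real (d j) - \<i> * of_real t)))"
    if "t \<noteq> 0" for t
  proof -
    let ?z = "\<i> * complex_of_real t"
    \<comment> \<open>A nonzero purely imaginary number is never a real eigenvalue.\<close>
    have z: "?z \<noteq> of_real (d j)" for j using that by (simp add: complex_eq_iff)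
    \<comment> \<open>Distributing the leading 1 over the weights \<open>c j\<close> lets it combine
      termwise with \<open>?z / (?z - of_real (d j))\<close>.\<close>
    have "(\<Sum>j<n. complex_of_real (c j)) = 1" by (metis c_sum of_real_1 of_real_sum)
    then have "f t = (\<Sum>j<n. of_real (c j)) - (\<Sum>j<n. of_real (c j) * (?z / (?z - of_real (d j))))"
      unfolding f_def charpoly_minor_quotient[OF A wit i z] c_def[symmetric]
      by (simp add: sum_distrib_left ac_simps)
    also have "\<dots> = (\<Sum>j<n. of_real (c j) * (1 - ?z / (?z - of_real (d j))))"
      by (simp add: sum_subtractf right_diff_distrib)
    also have "\<dots> = (\<Sum>j<n. of_real (c j) * (of_real (d j) / (of_real (d j) - ?z)))"
    proof (rule sum.cong[OF refl])
      fix j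
      have "?z - of_real (d j) \<noteq> 0" "of_real (d j) - ?z \<noteq> 0" using z[of j] by auto
      then have "1 - ?z / (?z - of_real (d j)) = of_real (d j) / (of_real (d j) - ?z)"
        by (simp add: divide_simps) (simp add: algebra_simps)
      then show "of_real (c j) * (1 - ?z / (?z - of_real (d j)))
          = of_real (c j) * (of_real (d j) / (of_real (d j) - ?z))" by simp
    qed
    finally show ?thesis .
  qed
  define I where "I R = (\<Sum>j<n. c j * (2 * d j * arctan (R / d j)))" for R
  have int: "(f has_integral complex_of_real (I R)) {-R..R}" if "0 < R" for R
  proof -
    have "((\<lambda>t. \<Sum>j<n. of_real (c j) * (of_real (d j) / (of_real (d j) - \<i> * of_real t)))
        has_integral (\<Sum>j<n. of_real (c j) * complex_of_real (2 * d j * arctan (R / d j)))) {-R..R}"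
      using that by (intro has_integral_sum has_integral_mult_right has_integral_resolvent_term) auto
    then have "((\<lambda>t. \<Sum>j<n. of_real (c j) * (of_real (d j) / (of_real (d j) - \<i> * of_real t)))
        has_integral complex_of_real (I R)) {-R..R}"
      by (simp add: I_def)
    then show ?thesis
      \<comment> \<open>At \<open>t = 0\<close> the integrand is 1 by its formula, while the sum
        omits the weights of zero eigenvalues; a single point does not affect the integral.\<close>
      by (rule has_integral_spike_finite[of "{0}", rotated 2]) (auto simp: f_eq)
  qed
  have "abs_mat A $$ (i, i) = (\<Sum>j<n. c j * \<bar>d j\<bar>)"
    unfolding abs_mat_similar_diag[OF A sym wit] conj_mat_diag_index[OF w(6,7) i i] c_def ..
  then have lim_eq: "(\<Sum>j<n. c j * (pi * \<bar>d j\<bar>)) = pi * abs_mat A $$ (i, i)"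
    by (simp add: sum_distrib_left mult.left_commute)
  have "(I \<longlongrightarrow> pi * abs_mat A $$ (i, i)) at_top"
    unfolding I_def[abs_def] lim_eq[symmetric]
    by (intro tendsto_sum tendsto_mult tendsto_const tendsto_mult_arctan_divide)
  then have "((\<lambda>R. complex_of_real (I R)) \<longlongrightarrow> of_real (pi * abs_mat A $$ (i, i))) at_top"
    by (rule tendsto_of_real)
  moreover have "\<forall>\<^sub>F R in at_top. complex_of_real (I R) = integral {-R..R} f"
    using eventually_gt_at_top[of 0] by eventually_elim (use int integral_unique in metis)
  ultimately have lim: "((\<lambda>R. integral {-R..R} f) \<longlongrightarrow> of_real (pi * abs_mat A $$ (i, i))) at_top"
    by (rule Lim_transform_eventually)
  show "pv_integrable f" unfolding pv_integrable_def using int lim by blast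
  show "pv_integral f = complex_of_real (pi * abs_mat A $$ (i, i))"
    unfolding pv_integral_def by (rule tendsto_Lim[OF trivial_limit_at_top_linorder lim])
qed

section \<open>Application to Seidel matrices\<close>

lemma transpose_seidel_mat:
  assumes "graph G"
  shows "transpose_mat (seidel_mat G vs) = seidel_mat G vs"
proof -
  interpret graph G by fact
  show ?thesis by (rule eq_matI) (use arcs_ends_symmetric[OF sym_arcs] in \<open>auto simp: seidel_mat_def\<close>)
qed

theorem theorem5:
  fixes G :: "('a, 'b) pre_digraph" and vs :: "'a list" and i :: nat
  defines "S \<equiv> seidel_mat G vs"
  defines "\<Phi> \<equiv> charpoly_at S"
  defines "\<Phi>\<^sub>i \<equiv> charpoly_at (mat_delete S i i)"
  defines "f \<equiv> (\<lambda>t::real. 1 - \<i> * complex_of_real t *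
             (\<Phi>\<^sub>i (\<i> * complex_of_real t) / \<Phi> (\<i> * complex_of_real t)))"
  assumes "graph G" and "vertex_enumeration G vs" and "i < length vs"
  shows "pv_integrable f \<and>
         complex_of_real (vertex_seidel_energy G vs i) = 1 / complex_of_real pi * pv_integral f"
proof -
  have S: "S \<in> carrier_mat (length vs) (length vs)" by (simp add: S_def seidel_mat_def)
  have sym: "transpose_mat S = S"
    unfolding S_def by (rule transpose_seidel_mat) fact
  note C = Coulson_integral_abs_mat[OF S sym \<open>i < length vs\<close>]
  have "pv_integrable f" and "pv_integral f = complex_of_real (pi * abs_mat S $$ (i, i))"
    unfolding f_def \<Phi>_def \<Phi>\<^sub>i_def by (fact C)+
  then show ?thesis by (simp add: vertex_seidel_energy_def S_def)
qed

end
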